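(* Let $(X,d)$ be a compact metric space, $f:X\to X$ a homeomorphism, and $\pi_0$ a Borel probability measure on $X$. Let $C_0\in[0,\infty]$ be the smallest channel capacity above which the asymptotic almost sure estimation objective (E2) can be achieved for every $\varepsilon>0$. (i) If $\pi_0$ is $f$-invariant, then $C_0\ge h_{\pi_0}(f)$. (ii) If $\pi_0$ is not $f$-invariant, but there exists an $f$-invariant Borel probability measure $\pi_*$ on $X$ which is absolutely continuous with respect to $\pi_0$, then $C_0\ge h_{\pi_*}(f)$. Here the cases $h_{\pi_0}(f)=\infty$ and $h_{\pi_*}(f)=\infty$, respectively, are included; they correspond to the situation when the objective (for every $\varepsilon>0$) cannot be achieved over a finite-capacity channel, i.e. $C_0=\infty$.
   Context: All logarithms are to base $2$. The system is $x_{t+1}=f(x_t)$ with random initial state $x_0$ distributed according to $\pi_0$. Policies: given a finite nonempty alphabet $\mathcal{M}$ (noiseless channel of capacity $C=\log|\mathcal{M}|$), a coding and estimation policy consists of measurable maps $\delta_t:X^{t+1}\to\mathcal{M}$ and maps $\gamma_t:\mathcal{M}^{t+1}\to X$, $t=0,1,2,\dots$. For initial state $x_0$, put $x_t=f^t(x_0)$, $q_t=\delta_t(x_0,x_1,\dots,x_t)$ and $\hat{x}_t=\hat{x}_t(x_0)=\gamma_t(q_0,q_1,\dots,q_t)$. Objective (E2) for a given $\varepsilon>0$: $\pi_0(\{x_0\in X:\limsup_{t\to\infty}d(f^t(x_0),\hat{x}_t(x_0))\le\varepsilon\})=1$. $C_0$: for $\varepsilon>0$ let $C_\varepsilon$ be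 the infimum of $\log|\mathcal{M}|$ over all finite alphabets $\mathcal{M}$ for which there is a coding and estimation policy achieving the objective for this $\varepsilon$ (with $\inf\emptyset=\infty$); then $C_0:=\lim_{\varepsilon\downarrow0}C_\varepsilon$. Metric entropy of an $f$-invariant Borel probability measure $\mu$: for a finite Borel partition $\mathcal{P}$ of $X$, $\mathcal{P}^n:=\bigvee_{i=0}^{n-1}f^{-i}\mathcal{P}$, $H_\mu(\mathcal{P}^n)=-\sum_{P\in\mathcal{P}^n}\mu(P)\log\mu(P)$, $h_\mu(f;\mathcal{P}):=\lim_{n\to\infty}\frac1nH_\mu(\mathcal{P}^n)$, and $h_\mu(f):=\sup_{\mathcal{P}}h_\mu(f;\mathcal{P})\in[0,\infty]$ over all finite Borel partitions. *)

theory Defs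
  imports "HOL-Probability.Probability"
begin

text \<open>
  The compact metric space \<open>X\<close> is the universe of a type of class \<open>metric_space\<close>; compactness is
  assumed where it is needed.
\<close>

definition borel_prob :: "'a::topological_space measure \<Rightarrow> bool" where
  "borel_prob \<mu> \<longleftrightarrow> prob_space \<mu> \<and> sets \<mu> = sets borel"

definition invariant_measure :: "('a::topological_space \<Rightarrow> 'a) \<Rightarrow> 'a measure \<Rightarrow> bool" where
  "invariant_measure f \<mu> \<longleftrightarrow> distr \<mu> borel f = \<mu>"

definition finite_borel_partition :: "'a::topological_space set set \<Rightarrow> bool" where
  "finite_borel_partition P \<longleftrightarrow> finite P \<and> partition_on UNIV P \<and> P \<subseteq> sets borel"

definition refined_partition :: "('a \<Rightarrow> 'a) \<Rightarrow> 'a set set \<Rightarrow> nat \<Rightarrow> 'a set set" where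
  "refined_partition f P n = common_refinement ((\<lambda>i. (\<lambda>A. (f ^^ i) -` A) ` P) ` {..<n})"

text \<open>The convention \<open>0 log 0 = 0\<close> is automatic, since \<open>0 * x = 0\<close>.\<close>

definition partition_entropy :: "'a measure \<Rightarrow> 'a set set \<Rightarrow> real" where
  "partition_entropy \<mu> P = - (\<Sum>A\<in>P. measure \<mu> A * log 2 (measure \<mu> A))"

definition metric_entropy_wrt :: "'a measure \<Rightarrow> ('a \<Rightarrow> 'a) \<Rightarrow> 'a set set \<Rightarrow> real" where
  "metric_entropy_wrt \<mu> f P = lim (\<lambda>n. 1 / real n * partition_entropy \<mu> (refined_partition f P n))"

definition metric_entropy :: "'a::topological_space measure \<Rightarrow> ('a \<Rightarrow> 'a) \<Rightarrow> ereal" where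
  "metric_entropy \<mu> f = (SUP P\<in>{P. finite_borel_partition P}. ereal (metric_entropy_wrt \<mu> f P))"

text \<open>
  Alphabets are finite nonempty sets of natural numbers, which represents every finite alphabet
  up to renaming of its symbols. A word of length \<open>t + 1\<close> is an extensional function on \<open>{..t}\<close>.
  The product sigma-algebra on \<open>X\<^sup>t\<^sup>+\<^sup>1\<close> coincides with the Borel one, as compact
  metric spaces are second countable.
\<close>

definition coding_policy :: "nat set \<Rightarrow> (nat \<Rightarrow> (nat \<Rightarrow> 'a::topological_space) \<Rightarrow> nat) \<Rightarrow> bool" where
  "coding_policy M \<delta> \<longleftrightarrow> (\<forall>t. \<delta> t \<in> measurable (PiM {..t} (\<lambda>_. borel)) (count_space M))"

definition coded_symbol ::
    "('a \<Rightarrow> 'a) \<Rightarrow> (nat \<Rightarrow> (nat \<Rightarrow> 'a) \<Rightarrow> nat) \<Rightarrow> 'a \<Rightarrow> nat \<Rightarrow> nat" where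
  "coded_symbol f \<delta> x t = \<delta> t (\<lambda>s\<in>{..t}. (f ^^ s) x)"

text \<open>
  The estimator maps need no side condition: they are total, only their values on words over the
  alphabet are used, and every map on a finite discrete space is measurable.
\<close>

definition state_estimate ::
    "('a \<Rightarrow> 'a) \<Rightarrow> (nat \<Rightarrow> (nat \<Rightarrow> 'a) \<Rightarrow> nat) \<Rightarrow> (nat \<Rightarrow> (nat \<Rightarrow> nat) \<Rightarrow> 'a) \<Rightarrow> 'a \<Rightarrow> nat \<Rightarrow> 'a" where
  "state_estimate f \<delta> \<gamma> x t = \<gamma> t (\<lambda>s\<in>{..t}. coded_symbol f \<delta> x s)"

definition as_estimation_objective ::
    "('a::metric_space \<Rightarrow> 'a) \<Rightarrow> 'a measure \<Rightarrow> real \<Rightarrow>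
     (nat \<Rightarrow> (nat \<Rightarrow> 'a) \<Rightarrow> nat) \<Rightarrow> (nat \<Rightarrow> (nat \<Rightarrow> nat) \<Rightarrow> 'a) \<Rightarrow> bool" where
  "as_estimation_objective f \<pi> \<epsilon> \<delta> \<gamma> \<longleftrightarrow>
     measure \<pi> {x. limsup (\<lambda>t. ereal (dist ((f ^^ t) x) (state_estimate f \<delta> \<gamma> x t))) \<le> ereal \<epsilon>} = 1"

definition sufficient_alphabet ::
    "('a::metric_space \<Rightarrow> 'a) \<Rightarrow> 'a measure \<Rightarrow> real \<Rightarrow> nat set \<Rightarrow> bool" where
  "sufficient_alphabet f \<pi> \<epsilon> M \<longleftrightarrow>
     finite M \<and> M \<noteq> {} \<and> (\<exists>\<delta> \<gamma>. coding_policy M \<delta> \<and> as_estimation_objective f \<pi> \<epsilon> \<delta> \<gamma>)"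

definition eps_capacity :: "('a::metric_space \<Rightarrow> 'a) \<Rightarrow> 'a measure \<Rightarrow> real \<Rightarrow> ereal" where
  "eps_capacity f \<pi> \<epsilon> = (INF M\<in>{M. sufficient_alphabet f \<pi> \<epsilon> M}. ereal (log 2 (real (card M))))"

definition smallest_capacity :: "('a::metric_space \<Rightarrow> 'a) \<Rightarrow> 'a measure \<Rightarrow> ereal" where
  "smallest_capacity f \<pi> = Lim (at_right 0) (eps_capacity f \<pi>)"

end

theory Submission
  imports Defs
begin

text \<open>
  Let \<open>\<mu> \<lless> \<pi>\<^sub>0\<close> be invariant and let \<open>P\<close> be a finite Borel partition. Shrink its cells to disjoint
  compact sets \<open>C A \<subseteq> A\<close> carrying almost all of the mass. If \<open>\<epsilon>\<close> is small compared to the distances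
  between these sets, then an estimate of \<open>f\<^sup>t x\<close> with error at most \<open>\<epsilon>\<close> determines the cell of
  \<open>f\<^sup>t x\<close> unless \<open>f\<^sup>t x\<close> lies outside all of the compact sets. Hence, for all large \<open>t\<close>, the \<open>t\<close>-th
  symbol of the \<open>P\<close>-itinerary of \<open>x\<close> is decoded correctly from the transmitted word, up to an event
  of small probability. The Gibbs inequality, applied to the output distribution of a uniformly
  distributed codeword sent through the decoder followed by a noisy channel with error rate \<open>\<theta>\<close>, then
  bounds the entropy of itineraries of length \<open>n\<close> by \<open>n log |M| + n \<eta> + O(1)\<close>.
\<close>

subsection \<open>Subadditive sequences and regularity of Borel measures\<close>

text \<open>Fekete's lemma: writing \<open>n = q * m + r\<close> with \<open>r < m\<close> gives
  \<open>u n \<le> q * u m + u r\<close>, so up to a vanishing remainder no quotient exceeds the one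
  at a fixed \<open>m\<close>. The limit is therefore the infimum \<open>L\<close>, which exists by
  nonnegativity.\<close>

lemma subadditive_imp_convergent:
  fixes u :: "nat \<Rightarrow> real"
  assumes sub: "\<And>m n. u (m + n) \<le> u m + u n" and nonneg: "\<And>n. 0 \<le> u n"
  shows "convergent (\<lambda>n. u n / real n)"
proof -
  define L where "L = (INF n\<in>{1..}. u n / real n)"
  have bdd: "bdd_below ((\<lambda>n. u n / real n) ` {1..})"
    using nonneg by (intro bdd_belowI[of _ 0]) auto
  have lower: "L \<le> u n / real n" if "n \<ge> 1" for n
    unfolding L_def by (rule cINF_lower[OF bdd]) (use that in auto)
  have multiple: "u (q * m + r) \<le> real q * u m + u r" for q m r
  proof (induction q)
    case (Suc q)
    have "u (Suc q * m + r) = u (m + (q * m + r))" by (simp add: algebra_simps)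
    also have "\<dots> \<le> u m + u (q * m + r)" by (rule sub)
    finally show ?case using Suc by (simp add: algebra_simps)
  qed simp
  have "(\<lambda>n. u n / real n) \<longlonglongrightarrow> L"
  proof (rule LIMSEQ_I)
    fix e :: real assume e: "0 < e"
    have "\<exists>m\<in>{1..}. u m / real m < L + e / 2"
      using cInf_lessD[of "(\<lambda>n. u n / real n) ` {1..}" "L + e / 2"] e unfolding L_def by auto
    then obtain m where m: "m \<ge> 1" "u m / real m < L + e / 2" by auto
    \<comment> \<open>Bounds every remainder term \<open>u (n mod m)\<close> at once, independently
      of \<open>n\<close>.\<close>
    define K where "K = (\<Sum>r<m. u r)"
    have K0: "0 \<le> K" unfolding K_def using nonneg by (intro sum_nonneg) auto
    obtain N where N: "2 * K / e < real N" using reals_Archimedean2 by blast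
    have "norm (u n / real n - L) < e" if n: "n \<ge> Suc N" for n
    proof -
      have n0: "real n > 0" using n by simp
      have "u n = u (n div m * m + n mod m)" by simp
      also have "\<dots> \<le> real (n div m) * u m + u (n mod m)" by (rule multiple)
      also have "u (n mod m) \<le> K" unfolding K_def
        by (rule member_le_sum) (use m nonneg in auto)
      also have "real (n div m) * u m \<le> real n / real m * u m"
        by (intro mult_right_mono nonneg) (rule of_nat_div_le_of_nat)
      finally have "u n \<le> real n * (u m / real m) + K" by simp
      then have "u n / real n \<le> u m / real m + K / real n"
        using n0 by (simp add: field_simps)
      moreover have "K / real n < e / 2"
      proof -
        have "2 * K / e < real n" using N n by linarith
        then show ?thesis using e n0 by (simp add: field_simps)
      qed
      moreover have "L \<le> u n / real n" using n by (intro lower) auto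
      ultimately show ?thesis
        using m(2) e unfolding real_norm_def abs_less_iff by linarith
    qed
    then show "\<exists>N. \<forall>n\<ge>N. norm (u n / real n - L) < e" by blast
  qed
  then show ?thesis by (rule convergentI)
qed

text \<open>Induction over the sigma-algebra generated by the closed sets. Only the closed set is
  wanted later; the open one is carried along because taking complements exchanges the two.\<close>

lemma closed_open_approximation:
  fixes M :: "'a::metric_space measure"
  assumes "finite_measure M" and sets: "sets M = sets borel" and B: "B \<in> sets borel" and e: "0 < e"
  shows "\<exists>C U. closed C \<and> open U \<and> C \<subseteq> B \<and> B \<subseteq> U \<and> measure M (U - C) < e"
proof -
  interpret finite_measure M by fact
  note [measurable_cong] = sets
  have "B \<in> sigma_sets UNIV (Collect closed)"
    using B by (simp add: borel_eq_closed)
  then show ?thesis using e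
  proof (induction arbitrary: e rule: sigma_sets.induct)
    case (Basic S)
    then have S: "closed S" by simp
    show ?case
    \<comment> \<open>The distance to the empty set is 0 by convention, so its neighbourhoods
      \<open>U n\<close> would not shrink.\<close>
    proof (cases "S = {}")
      case True
      then show ?thesis using Basic(2) closed_empty open_empty
        by (metis Diff_cancel measure_empty order_refl)
    next
      case False
      define U where "U n = {x. infdist x S < 1 / real (Suc n)}" for n
      have U: "open (U n)" for n
        unfolding U_def by (intro open_Collect_less continuous_intros)
      have "(\<Inter>n. U n) = S"
      proof
        show "S \<subseteq> (\<Inter>n. U n)" unfolding U_def by auto
        show "(\<Inter>n. U n) \<subseteq> S"
        proof
          fix x assume x: "x \<in> (\<Inter>n. U n)"
          have "infdist x S \<le> 0"
          proof (rule ccontr)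
            assume "\<not> infdist x S \<le> 0"
            then obtain n where "inverse (real (Suc n)) < infdist x S"
              using reals_Archimedean[of "infdist x S"] by auto
            moreover have "infdist x S < 1 / real (Suc n)" using x unfolding U_def by blast
            ultimately show False by (simp add: inverse_eq_divide)
          qed
          then have "infdist x S = 0" using infdist_nonneg[of x S] by simp
          then show "x \<in> S" using S False by (simp add: in_closed_iff_infdist_zero)
        qed
      qed
      then have empty: "(\<Inter>n. U n - S) = {}" by blast
      have lim: "(\<lambda>n. measure M (U n - S)) \<longlonglongrightarrow> measure M (\<Inter>n. U n - S)"
      proof (rule finite_Lim_measure_decseq)
        show "range (\<lambda>n. U n - S) \<subseteq> sets M" using U S sets by auto
        show "decseq (\<lambda>n. U n - S)"
          unfolding decseq_def U_def
          by (force simp: frac_le intro: less_le_trans)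
      qed
      have "(\<lambda>n. measure M (U n - S)) \<longlonglongrightarrow> 0"
        using lim unfolding empty measure_empty .
      then have "\<forall>\<^sub>F n in sequentially. measure M (U n - S) < e"
        by (rule order_tendstoD) (rule Basic)
      then obtain n where "measure M (U n - S) < e"
        by (auto simp: eventually_sequentially)
      moreover have "S \<subseteq> U n" unfolding U_def by auto
      ultimately show ?thesis using S U by blast
    qed
  next
    case Empty
    then have "measure M ({} - {}) < e" by simp
    then show ?case
      using closed_empty open_empty by (intro exI[of _ "{}"] conjI subset_refl)
  next
    case (Compl S)
    obtain C U where "closed C" "open U" "C \<subseteq> S" "S \<subseteq> U" "measure M (U - C) < e"
      using Compl.IH[OF Compl.prems] by blast
    moreover have "- C - - U = U - C" by auto
    ultimately have "closed (- U) \<and> open (- C) \<and> - U \<subseteq> UNIV - S \<and> UNIV - S \<subseteq> - C \<and>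
        measure M (- C - - U) < e"
      by (auto simp: closed_def)
    then show ?case by blast
  next
    case (Union A)
    \<comment> \<open>The geometric tolerances add up to \<open>e / 2\<close>. The rest of
      \<open>e\<close> pays for keeping only finitely many of the \<open>C i\<close>, since a
      countable union of closed sets need not be closed.\<close>
    have "\<exists>C U. closed C \<and> open U \<and> C \<subseteq> A i \<and> A i \<subseteq> U \<and> measure M (U - C) < e / 2 * (1 / 2) ^ Suc i" for i
      using Union.prems by (intro Union.IH) simp
    then obtain C U where CU: "\<And>i. closed (C i)" "\<And>i. open (U i)" "\<And>i. C i \<subseteq> A i" "\<And>i. A i \<subseteq> U i"
      "\<And>i. measure M (U i - C i) < e / 2 * (1 / 2) ^ Suc i"
      by metis
    have sums: "(\<lambda>i. e / 2 * (1 / 2) ^ Suc i) sums (e / 2)"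
      using sums_mult[OF power_half_series, of "e / 2"] by simp
    have summ: "summable (\<lambda>i. measure M (U i - C i))"
      by (rule summable_comparison_test'[OF sums_summable[OF sums], of 0])
        (use CU(5) in \<open>auto intro: less_imp_le\<close>)
    have ev: "U i - C i \<in> sets M" for i using CU sets by auto
    have lim: "(\<lambda>n. measure M ((\<Union>i. U i) - (\<Union>i<n. C i))) \<longlonglongrightarrow>
        measure M (\<Inter>n. (\<Union>i. U i) - (\<Union>i<n. C i))"
    proof (rule finite_Lim_measure_decseq)
      show "range (\<lambda>n. (\<Union>i. U i) - (\<Union>i<n. C i)) \<subseteq> sets M"
        using CU(1,2) sets by auto
      show "decseq (\<lambda>n. (\<Union>i. U i) - (\<Union>i<n. C i))"
        unfolding decseq_def by force
    qed
    have "measure M (\<Inter>n. (\<Union>i. U i) - (\<Union>i<n. C i)) \<le> measure M (\<Union>i. U i - C i)"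
      using ev by (intro finite_measure_mono) blast+
    also have "\<dots> \<le> (\<Sum>i. measure M (U i - C i))"
      using ev by (intro finite_measure_subadditive_countably summ) auto
    also have "\<dots> \<le> (\<Sum>i. e / 2 * (1 / 2) ^ Suc i)"
      by (intro suminf_le summ sums_summable[OF sums] less_imp_le CU(5))
    also have "\<dots> = e / 2" using sums by (rule sums_unique[symmetric])
    also have "\<dots> < e" using Union.prems by simp
    finally have "\<forall>\<^sub>F n in sequentially. measure M ((\<Union>i. U i) - (\<Union>i<n. C i)) < e"
      using lim by (intro order_tendstoD(2))
    then obtain n where "measure M ((\<Union>i. U i) - (\<Union>i<n. C i)) < e"
      by (auto simp: eventually_sequentially)
    moreover have "closed (\<Union>i<n. C i)" "open (\<Union>i. U i)" using CU by auto
    moreover have "(\<Union>i<n. C i) \<subseteq> (\<Union>i. A i)" by (rule UN_mono) (use CU(3) in auto)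
    moreover have "(\<Union>i. A i) \<subseteq> (\<Union>i. U i)" by (rule UN_mono) (use CU(4) in auto)
    ultimately show ?case by (intro exI conjI)
  qed
qed

subsection \<open>Itineraries and entropy\<close>

definition partition_cell :: "'a set set \<Rightarrow> 'a \<Rightarrow> 'a set" where
  "partition_cell P x = (THE A. A \<in> P \<and> x \<in> A)"

lemma partition_cell_eq:
  assumes "partition_on UNIV P" "A \<in> P" "x \<in> A"
  shows "partition_cell P x = A"
  unfolding partition_cell_def
  using assms by (intro the_equality) (auto simp: partition_on_def disjoint_def)

lemma partition_cell:
  assumes "partition_on UNIV P"
  shows "partition_cell P x \<in> P" and "x \<in> partition_cell P x"
proof -
  obtain A where "A \<in> P" "x \<in> A" using partition_onD1[OF assms] by blast
  with partition_cell_eq[OF assms this]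
  show "partition_cell P x \<in> P" and "x \<in> partition_cell P x" by auto
qed

text \<open>Extensionality makes words of length \<open>n\<close> elements of a finite product set,
  and equality of words the same as agreement in the first \<open>n\<close> symbols.\<close>

definition itinerary :: "('a \<Rightarrow> 'a) \<Rightarrow> 'a set set \<Rightarrow> nat \<Rightarrow> 'a \<Rightarrow> nat \<Rightarrow> 'a set" where
  "itinerary f P n x = (\<lambda>i\<in>{..<n}. partition_cell P ((f ^^ i) x))"

lemma itinerary_in_PiE:
  assumes "partition_on UNIV P"
  shows "itinerary f P n x \<in> PiE {..<n} (\<lambda>_. P)"
  unfolding itinerary_def using partition_cell(1)[OF assms] by auto

lemma itinerary_eq_iff:
  assumes "partition_on UNIV P"
  shows "itinerary f P n y = itinerary f P n x \<longleftrightarrow>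
    (\<forall>i<n. (f ^^ i) y \<in> partition_cell P ((f ^^ i) x))"
proof
  assume "itinerary f P n y = itinerary f P n x"
  then show "\<forall>i<n. (f ^^ i) y \<in> partition_cell P ((f ^^ i) x)"
    using partition_cell(2)[OF assms] unfolding itinerary_def
    by (metis (no_types, lifting) lessThan_iff restrict_apply')
next
  assume "\<forall>i<n. (f ^^ i) y \<in> partition_cell P ((f ^^ i) x)"
  then show "itinerary f P n y = itinerary f P n x"
    unfolding itinerary_def
    by (intro restrict_ext) (use partition_cell_eq[OF assms] partition_cell(1)[OF assms] in auto)
qed

text \<open>If an intersection of chosen pulled-back cells contains \<open>x\<close>, each choice is
  forced to be the cell that \<open>x\<close> visits at that time, so the intersection is the
  cylinder of \<open>x\<close>. Coinciding pullbacks for different times do no harm, as the forced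
  choices then coincide too.\<close>

lemma refined_partition_eq_fibres:
  assumes P: "partition_on UNIV P"
  shows "refined_partition f P n = (\<lambda>w. itinerary f P n -` {w}) ` range (itinerary f P n)"
proof -
  define \<P> where "\<P> = (\<lambda>i. (\<lambda>A. (f ^^ i) -` A) ` P) ` {..<n}"
  define cyl where "cyl x = itinerary f P n -` {itinerary f P n x}" for x
  have cyl: "cyl x = {y. \<forall>i<n. (f ^^ i) y \<in> partition_cell P ((f ^^ i) x)}" for x
    unfolding cyl_def using itinerary_eq_iff[OF P] by auto
  have Inter_eq: "\<Inter> (g ` \<P>) = cyl x" if g: "g \<in> (\<Pi> Q\<in>\<P>. Q)" and x: "x \<in> \<Inter> (g ` \<P>)" for g x
  proof -
    have "g ((\<lambda>A. (f ^^ i) -` A) ` P) = (f ^^ i) -` partition_cell P ((f ^^ i) x)" if "i < n" for i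
    proof -
      have Q: "(\<lambda>A. (f ^^ i) -` A) ` P \<in> \<P>" unfolding \<P>_def using that by auto
      then obtain A where A: "A \<in> P" "g ((\<lambda>A. (f ^^ i) -` A) ` P) = (f ^^ i) -` A"
        using g by (auto simp: Pi_iff image_iff)
      then have "(f ^^ i) x \<in> A" using x Q by auto
      then show ?thesis using partition_cell_eq[OF P A(1)] A(2) by simp
    qed
    then show ?thesis unfolding cyl \<P>_def by auto
  qed
  have "refined_partition f P n = range cyl"
  proof (intro equalityI subsetI)
    fix A assume "A \<in> refined_partition f P n"
    then obtain g x where "g \<in> (\<Pi> Q\<in>\<P>. Q)" "A = \<Inter> (g ` \<P>)" "x \<in> A"
      unfolding refined_partition_def common_refinement \<P>_def[symmetric] by blast
    then show "A \<in> range cyl" using Inter_eq by auto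
  next
    fix A assume "A \<in> range cyl"
    then obtain x where x: "A = cyl x" by auto
    \<comment> \<open>Conversely, the cylinder of \<open>x\<close> arises by choosing in each
      pullback the set that contains \<open>x\<close>.\<close>
    define g where "g Q = (SOME B. B \<in> Q \<and> x \<in> B)" for Q
    have g: "g Q \<in> Q \<and> x \<in> g Q" if "Q \<in> \<P>" for Q
    proof -
      have "\<exists>B. B \<in> Q \<and> x \<in> B"
        using that partition_cell[OF P] unfolding \<P>_def by fastforce
      then show ?thesis unfolding g_def by (rule someI_ex)
    qed
    then have "\<Inter> (g ` \<P>) = cyl x" by (intro Inter_eq) auto
    then show "A \<in> refined_partition f P n"
      unfolding refined_partition_def common_refinement \<P>_def[symmetric]
      using g x by (auto intro!: bexI[of _ g])
  qed
  then show ?thesis unfolding cyl_def by (simp add: image_image)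
qed

lemma finite_range_itinerary:
  assumes "partition_on UNIV P" "finite P"
  shows "finite (range (itinerary f P n))"
proof (rule finite_subset)
  show "range (itinerary f P n) \<subseteq> PiE {..<n} (\<lambda>_. P)"
    using itinerary_in_PiE[OF assms(1)] by blast
  show "finite (PiE {..<n} (\<lambda>_. P))"
    using assms(2) by (intro finite_PiE) auto
qed

lemma funpow_borel_measurable:
  fixes f :: "'a::topological_space \<Rightarrow> 'a"
  assumes "f \<in> borel \<rightarrow>\<^sub>M borel"
  shows "f ^^ n \<in> borel \<rightarrow>\<^sub>M borel"
  using assms by (induction n) (auto intro: measurable_comp simp: id_def)

lemma itinerary_simple_function:
  fixes f :: "'a::topological_space \<Rightarrow> 'a"
  assumes P: "finite_borel_partition P" and f: "f \<in> borel \<rightarrow>\<^sub>M borel" and M: "sets M = sets borel"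
  shows "simple_function M (itinerary f P n)"
proof -
  have P': "partition_on UNIV P" "finite P" "P \<subseteq> sets borel"
    using P unfolding finite_borel_partition_def by auto
  have sp: "space M = UNIV" using sets_eq_imp_space_eq[OF M] by simp
  have "itinerary f P n -` {itinerary f P n x} \<in> sets borel" for x
  proof -
    have "itinerary f P n -` {itinerary f P n x} =
      (\<Inter>i\<in>{..<n}. (f ^^ i) -` partition_cell P ((f ^^ i) x) \<inter> space borel) \<inter> space borel"
      using itinerary_eq_iff[OF P'(1)] by auto
    also have "\<dots> \<in> sets borel"
    proof (cases "n = 0")
      case False
      have "(f ^^ i) -` partition_cell P ((f ^^ i) x) \<inter> space borel \<in> sets borel" for i
        using partition_cell(1)[OF P'(1)] P'(3)
        by (intro measurable_sets[OF funpow_borel_measurable[OF f]]) blast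
      then show ?thesis using False by (intro sets.Int sets.finite_INT) auto
    qed simp
    finally show ?thesis .
  qed
  then show ?thesis
    unfolding simple_function_def using finite_range_itinerary[OF P'(1,2)] M by (auto simp: sp)
qed

lemma invariant_measure_funpow:
  fixes f :: "'a::topological_space \<Rightarrow> 'a"
  assumes inv: "invariant_measure f \<mu>" and f: "f \<in> borel \<rightarrow>\<^sub>M borel" and M: "sets \<mu> = sets borel"
    and B: "B \<in> sets borel"
  shows "measure \<mu> ((f ^^ n) -` B) = measure \<mu> B"
proof (induction n)
  case (Suc n)
  have sp: "space \<mu> = UNIV" using sets_eq_imp_space_eq[OF M] by simp
  have Bn: "(f ^^ n) -` B \<in> sets borel"
    using measurable_sets[OF funpow_borel_measurable[OF f] B, of n] by simp
  have f': "f \<in> \<mu> \<rightarrow>\<^sub>M borel" using f measurable_cong_sets[OF M refl] by blast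
  have "measure \<mu> ((f ^^ Suc n) -` B) = measure \<mu> (f -` ((f ^^ n) -` B))"
    by (simp only: funpow_Suc_right vimage_comp)
  also have "\<dots> = measure (distr \<mu> borel f) ((f ^^ n) -` B)"
    using measure_distr[OF f' Bn] sp by simp
  also have "\<dots> = measure \<mu> ((f ^^ n) -` B)"
    using inv unfolding invariant_measure_def by simp
  finally show ?case unfolding Suc .
qed simp

section \<open>Shannon entropy of itineraries and its growth rate\<close>

definition simple_entropy :: "'a measure \<Rightarrow> ('a \<Rightarrow> 'b) \<Rightarrow> real" where
  "simple_entropy M X = - (\<Sum>v\<in>X ` space M.
    measure M (X -` {v} \<inter> space M) * log 2 (measure M (X -` {v} \<inter> space M)))"

text \<open>Data processing, the chain rule, and the fact that conditioning does not increase
  entropy: H(g(X,Y)) \<le> H(X,Y) = H(X) + H(Y|X) \<le> H(X) + H(Y).\<close>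

lemma simple_entropy_function_of_pair_le:
  assumes "prob_space M" and X: "simple_function M X" and Y: "simple_function M Y"
    and Z: "\<And>x. Z x = g (X x) (Y x)"
  shows "simple_entropy M Z \<le> simple_entropy M X + simple_entropy M Y"
proof -
  interpret information_space M 2
    using assms(1) by (simp add: information_space_def information_space_axioms_def)
  let ?XY = "\<lambda>x. (X x, Y x)"
  have XY: "simple_function M ?XY" by (intro simple_function_Pair X Y)
  have Z': "Z = (\<lambda>(a, b). g a b) \<circ> ?XY" using Z by auto
  have sfZ: "simple_function M Z" unfolding Z' by (intro simple_function_compose XY)
  have le: "entropy 2 (count_space (Z ` space M)) Z \<le> entropy 2 (count_space (?XY ` space M)) ?XY"
    unfolding Z' by (rule entropy_data_processing[OF XY])
  have chain: "entropy 2 (count_space (?XY ` space M)) ?XY \<le>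
      entropy 2 (count_space (X ` space M)) X + entropy 2 (count_space (Y ` space M)) Y"
    using entropy_chain_rule[OF X Y] conditional_entropy_less_eq_entropy[OF Y X] by linarith
  have "simple_entropy M Z = entropy 2 (count_space (Z ` space M)) Z"
    unfolding simple_entropy_def
    using entropy_simple_distributed[OF simple_distributedI[OF sfZ measure_nonneg refl]] by simp
  moreover have "simple_entropy M X = entropy 2 (count_space (X ` space M)) X"
    unfolding simple_entropy_def
    using entropy_simple_distributed[OF simple_distributedI[OF X measure_nonneg refl]] by simp
  moreover have "simple_entropy M Y = entropy 2 (count_space (Y ` space M)) Y"
    unfolding simple_entropy_def
    using entropy_simple_distributed[OF simple_distributedI[OF Y measure_nonneg refl]] by simp
  ultimately show ?thesis using le chain by linarith
qed

lemma partition_entropy_refined: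
  assumes P: "partition_on UNIV P" and sp: "space \<mu> = UNIV"
  shows "partition_entropy \<mu> (refined_partition f P n) = simple_entropy \<mu> (itinerary f P n)"
proof -
  have "inj_on (\<lambda>w. itinerary f P n -` {w}) (range (itinerary f P n))"
    by (rule inj_onI) auto
  then show ?thesis
    unfolding partition_entropy_def refined_partition_eq_fibres[OF P]
    by (simp add: sum.reindex simple_entropy_def sp)
qed

text \<open>An itinerary of length \<open>m + n\<close> consists of its first \<open>m\<close>
  symbols and the \<open>n\<close>-itinerary of \<open>(f ^^ m) x\<close>. By invariance the second
  block has the same distribution as the itinerary of length \<open>n\<close>.\<close>

lemma refined_entropy_subadditive:
  fixes f :: "'a::topological_space \<Rightarrow> 'a"
  assumes P: "finite_borel_partition P" and f: "f \<in> borel \<rightarrow>\<^sub>M borel" and \<mu>: "borel_prob \<mu>"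
    and inv: "invariant_measure f \<mu>"
  shows "partition_entropy \<mu> (refined_partition f P (m + n)) \<le>
    partition_entropy \<mu> (refined_partition f P m) + partition_entropy \<mu> (refined_partition f P n)"
proof -
  have M: "sets \<mu> = sets borel" and "prob_space \<mu>" using \<mu> unfolding borel_prob_def by auto
  interpret prob_space \<mu> by fact
  have sp: "space \<mu> = UNIV" using sets_eq_imp_space_eq[OF M] by simp
  have P': "partition_on UNIV P" using P unfolding finite_borel_partition_def by simp
  let ?I = "itinerary f P"
  note sf = itinerary_simple_function[OF P f M]
  have shift: "?I n \<circ> (f ^^ m) = (\<lambda>w. \<lambda>i\<in>{..<n}. w (m + i)) \<circ> ?I (m + n)"
  proof (intro ext)
    fix x i
    have "(f ^^ i) ((f ^^ m) x) = (f ^^ (m + i)) x"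
      by (metis add.commute comp_apply funpow_add)
    then show "(?I n \<circ> (f ^^ m)) x i = ((\<lambda>w. \<lambda>i\<in>{..<n}. w (m + i)) \<circ> ?I (m + n)) x i"
      by (simp add: itinerary_def)
  qed
  have sf': "simple_function \<mu> (?I n \<circ> (f ^^ m))"
    unfolding shift by (rule simple_function_compose[OF sf])
  define g where "g v w = (\<lambda>i\<in>{..<m + n}. if i < m then v i else w (i - m))"
    for v w :: "nat \<Rightarrow> 'a set"
  have split: "?I (m + n) x = g (?I m x) ((?I n \<circ> (f ^^ m)) x)" for x
  proof (rule ext)
    fix i
    show "?I (m + n) x i = g (?I m x) ((?I n \<circ> (f ^^ m)) x) i"
    proof (cases "i < m")
      case False
      then have "(f ^^ (i - m)) ((f ^^ m) x) = (f ^^ i) x"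
        by (metis comp_apply funpow_add le_add_diff_inverse2 not_less)
      then show ?thesis using False by (auto simp: g_def itinerary_def)
    qed (auto simp: g_def itinerary_def)
  qed
  have "simple_entropy \<mu> (?I (m + n)) \<le> simple_entropy \<mu> (?I m) + simple_entropy \<mu> (?I n \<circ> (f ^^ m))"
    by (rule simple_entropy_function_of_pair_le[where g = g, OF \<open>prob_space \<mu>\<close> sf sf' split])
  also have "simple_entropy \<mu> (?I n \<circ> (f ^^ m)) = simple_entropy \<mu> (?I n)"
  proof -
    let ?p = "\<lambda>w. prob (?I n -` {w})"
    have fib: "?I n -` {w} \<in> sets borel" for w
      using simple_functionD(2)[OF sf, of n "{w}"] M sp by simp
    have p: "prob ((?I n \<circ> (f ^^ m)) -` {w}) = ?p w" for w
      using invariant_measure_funpow[OF inv f M fib, of m w] by (simp add: vimage_comp)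
    \<comment> \<open>As \<open>f\<close> is only assumed Borel here, \<open>f ^^ m\<close> may fail
      to be onto and the shifted block may attain fewer words; the missing words have probability
      0.\<close>
    have "(\<Sum>w\<in>range (?I n \<circ> (f ^^ m)). ?p w * log 2 (?p w)) = (\<Sum>w\<in>range (?I n). ?p w * log 2 (?p w))"
    proof (rule sum.mono_neutral_left)
      show "finite (range (?I n))" using simple_functionD(1)[OF sf, of n] sp by simp
      show "\<forall>w\<in>range (?I n) - range (?I n \<circ> (f ^^ m)). ?p w * log 2 (?p w) = 0"
      proof
        fix w assume "w \<in> range (?I n) - range (?I n \<circ> (f ^^ m))"
        then have "(?I n \<circ> (f ^^ m)) y \<noteq> w" for y by (metis DiffD2 rangeI)
        then have "(?I n \<circ> (f ^^ m)) -` {w} = {}" by blast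
        then have "?p w = 0" using p[of w] by simp
        then show "?p w * log 2 (?p w) = 0" by simp
      qed
    qed auto
    then show ?thesis
      unfolding simple_entropy_def by (simp only: sp p Int_UNIV_right)
  qed
  finally show ?thesis
    unfolding partition_entropy_refined[OF P' sp] .
qed

text \<open>Ensures that the \<open>lim\<close> in \<open>metric_entropy_wrt\<close> is a genuine
  limit, so that bounds for finite \<open>n\<close> pass to it.\<close>

lemma refined_entropy_converges:
  fixes f :: "'a::topological_space \<Rightarrow> 'a"
  assumes P: "finite_borel_partition P" and f: "f \<in> borel \<rightarrow>\<^sub>M borel" and \<mu>: "borel_prob \<mu>"
    and inv: "invariant_measure f \<mu>"
  shows "(\<lambda>n. 1 / real n * partition_entropy \<mu> (refined_partition f P n)) \<longlonglongrightarrow> metric_entropy_wrt \<mu> f P"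
proof -
  interpret prob_space \<mu> using \<mu> unfolding borel_prob_def by simp
  have "convergent (\<lambda>n. partition_entropy \<mu> (refined_partition f P n) / real n)"
  proof (rule subadditive_imp_convergent)
    show "0 \<le> partition_entropy \<mu> (refined_partition f P n)" for n
    proof -
      have "measure \<mu> A * log 2 (measure \<mu> A) \<le> 0" for A
      proof (cases "measure \<mu> A = 0")
        case False
        then have "0 < measure \<mu> A" using measure_nonneg[of \<mu> A] by linarith
        then have "log 2 (measure \<mu> A) \<le> 0" using prob_le_1[of A] by simp
        then show ?thesis by (intro mult_nonneg_nonpos) auto
      qed simp
      then show ?thesis unfolding partition_entropy_def by (simp add: sum_nonpos)
    qed
  qed (rule refined_entropy_subadditive[OF P f \<mu> inv])
  then show ?thesis
    unfolding metric_entropy_wrt_def convergent_LIMSEQ_iff times_divide_eq_left mult_1_left .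
qed

subsection \<open>Entropy bound by code rate\<close>

text \<open>Gibbs inequality: coding \<open>X\<close> with lengths \<open>- log 2 (r v)\<close> from
  a subprobability \<open>r\<close> cannot beat the entropy on average. \<open>B\<close> is a
  pointwise bound for these lengths.\<close>

lemma simple_entropy_le_integral:
  assumes "prob_space M" and X: "simple_function M X"
    and pos: "\<And>x. x \<in> space M \<Longrightarrow> 0 < r (X x)"
    and total: "(\<Sum>v\<in>X ` space M. r v) \<le> 1"
    and B: "integrable M B" "\<And>x. x \<in> space M \<Longrightarrow> - log 2 (r (X x)) \<le> B x"
  shows "simple_entropy M X \<le> (\<integral>x. B x \<partial>M)"
proof -
  interpret prob_space M by fact
  define F where "F v = X -` {v} \<inter> space M" for v
  define p where "p v = measure M (F v)" for v
  note fin = simple_functionD(1)[OF X]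
  have F: "F v \<in> sets M" for v unfolding F_def by (rule simple_functionD(2)[OF X])
  \<comment> \<open>Expanding over the fibres of \<open>X\<close> yields integrability and the value
    of the integral together.\<close>
  have "has_bochner_integral M (\<lambda>x. \<Sum>v\<in>X ` space M. - log 2 (r v) * indicator (F v) x)
      (\<Sum>v\<in>X ` space M. - log 2 (r v) * p v)"
    unfolding p_def
    by (intro has_bochner_integral_sum has_bochner_integral_mult_right has_bochner_integral_real_indicator F)
      (simp add: less_top[symmetric])
  moreover have "(\<Sum>v\<in>X ` space M. - log 2 (r v) * indicator (F v) x) = - log 2 (r (X x))"
    if x: "x \<in> space M" for x
  proof -
    have "(\<Sum>v\<in>X ` space M. - log 2 (r v) * indicator (F v) x) =
        (\<Sum>v\<in>X ` space M. if v = X x then - log 2 (r v) else 0)"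
      by (rule sum.cong) (use x in \<open>auto simp: F_def indicator_def\<close>)
    also have "\<dots> = - log 2 (r (X x))" using fin x by simp
    finally show ?thesis .
  qed
  ultimately have int: "has_bochner_integral M (\<lambda>x. - log 2 (r (X x))) (\<Sum>v\<in>X ` space M. - log 2 (r v) * p v)"
    by (rule has_bochner_integral_cong[THEN iffD1, OF refl _ refl, rotated -1]) simp
  have "(\<Sum>v\<in>X ` space M. p v) = measure M (\<Union>v\<in>X ` space M. F v)"
    unfolding p_def using fin F
    by (intro finite_measure_finite_Union[symmetric]) (auto simp: disjoint_family_on_def F_def)
  also have "(\<Union>v\<in>X ` space M. F v) = space M" unfolding F_def by auto
  finally have p1: "(\<Sum>v\<in>X ` space M. p v) = 1" by (simp add: prob_space)
  \<comment> \<open>From ln z \<le> z - 1 at z = \<open>r v / p v\<close>. The corrections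
    \<open>(r v - p v) / ln 2\<close> have nonpositive sum, because \<open>r\<close> has mass at
    most 1 and \<open>p\<close> exactly 1.\<close>
  have gibbs: "- (p v * log 2 (p v)) \<le> - log 2 (r v) * p v + (r v - p v) / ln 2"
    if v: "v \<in> X ` space M" for v
  proof -
    have r: "0 < r v" using v pos by auto
    show ?thesis
    proof (cases "p v = 0")
      case False
      then have pv: "0 < p v" unfolding p_def by (simp add: order_less_le)
      have "ln (r v / p v) \<le> r v / p v - 1" using r pv by (intro ln_le_minus_one) simp
      then have "ln (r v) - ln (p v) \<le> r v / p v - 1" using r pv by (simp add: ln_div)
      then have "p v * (ln (r v) - ln (p v)) \<le> p v * (r v / p v - 1)"
        using pv by (intro mult_left_mono) auto
      also have "\<dots> = r v - p v" using pv by (simp add: field_simps)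
      finally have "p v * (ln (r v) - ln (p v)) / ln 2 \<le> (r v - p v) / ln 2"
        by (intro divide_right_mono) auto
      then show ?thesis by (simp add: log_def algebra_simps diff_divide_distrib)
    qed (use r in simp)
  qed
  have "simple_entropy M X = (\<Sum>v\<in>X ` space M. - (p v * log 2 (p v)))"
    unfolding simple_entropy_def p_def F_def by (simp add: sum_negf)
  also have "\<dots> \<le> (\<Sum>v\<in>X ` space M. - log 2 (r v) * p v + (r v - p v) / ln 2)"
    by (intro sum_mono gibbs)
  also have "\<dots> = (\<Sum>v\<in>X ` space M. - log 2 (r v) * p v) +
      ((\<Sum>v\<in>X ` space M. r v) - (\<Sum>v\<in>X ` space M. p v)) / ln 2"
    unfolding sum.distrib sum_divide_distrib[symmetric] sum_subtractf ..
  also have "\<dots> \<le> (\<Sum>v\<in>X ` space M. - log 2 (r v) * p v)"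
    using total p1 by (simp add: divide_nonpos_pos)
  also have "\<dots> = (\<integral>x. - log 2 (r (X x)) \<partial>M)"
    by (rule has_bochner_integral_integral_eq[OF int, symmetric])
  also have "\<dots> \<le> (\<integral>x. B x \<partial>M)"
    by (intro integral_mono B(1) integrable.intros[OF int] B(2))
  finally show ?thesis .
qed

text \<open>The three terms are a code length: naming the codeword, a price per symbol for trusting
  the decoder \<open>g\<close>, and a surcharge for symbols where decoding may fail. Only the
  expected number of failures enters, so neither independence nor stationarity is needed.\<close>

lemma simple_entropy_le_code_rate:
  fixes X :: "'a \<Rightarrow> nat \<Rightarrow> 'b" and q :: "'a \<Rightarrow> 'w"
  assumes "prob_space M" and X: "simple_function M X"
    and XA: "\<And>x. X x \<in> PiE {..<n} (\<lambda>_. A)" and A: "finite A" "A \<noteq> {}"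
    and q: "\<And>x. q x \<in> W" and W: "finite W"
    and E: "\<And>t. E t \<in> sets M"
    and decode: "\<And>t x. t < n \<Longrightarrow> x \<in> space M - E t \<Longrightarrow> X x t = g t (q x)"
    and \<theta>: "0 < \<theta>" "\<theta> < 1"
  shows "simple_entropy M X \<le> log 2 (card W) + real n * log 2 (1 / (1 - \<theta>)) +
    log 2 (card A / \<theta>) * (\<Sum>t<n. measure M (E t))"
proof -
  interpret prob_space M by fact
  \<comment> \<open>\<open>K a c\<close> is the probability that the noisy channel turns \<open>c\<close> into \<open>a\<close>, and \<open>r\<close> is the distribution
    of the output word when the codeword is uniform on \<open>W\<close>.\<close>
  define K where "K a c = \<theta> / card A + (if a = c then 1 - \<theta> else 0)" for a c :: 'b
  define R where "R w \<phi> = 1 / card W * (\<Prod>t<n. K (\<phi> t) (g t w))" for w \<phi>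
  define r where "r \<phi> = (\<Sum>w\<in>W. R w \<phi>)" for \<phi>
  have cA: "0 < card A" and cW: "0 < card W" using A W q by (auto simp: card_gt_0_iff)
  have K: "0 < K a c" "\<theta> / card A \<le> K a c" "1 - \<theta> \<le> K a a" for a c
    using \<theta> cA unfolding K_def by (auto simp: add_pos_nonneg)
  have R: "0 < R w \<phi>" for w \<phi>
    unfolding R_def using K(1) cW by (intro mult_pos_pos prod_pos) auto
  \<comment> \<open>Strict inequality is possible: the decoder may output a \<open>c\<close> outside
    \<open>A\<close>, and then the mass \<open>1 - \<theta>\<close> is lost.\<close>
  have Ksum: "(\<Sum>a\<in>A. K a c) \<le> 1" for c
  proof -
    have "(\<Sum>a\<in>A. K a c) = \<theta> + (\<Sum>a\<in>A. if a = c then 1 - \<theta> else 0)"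
      unfolding K_def using cA by (simp add: sum.distrib)
    also have "(\<Sum>a\<in>A. if a = c then 1 - \<theta> else 0) = (if c \<in> A then 1 - \<theta> else 0)"
      using A by (simp add: sum.delta)
    finally show ?thesis using \<theta> by auto
  qed
  have K0: "0 \<le> (\<Sum>a\<in>A. K a c)" for c by (intro sum_nonneg less_imp_le K(1))
  have Rsum: "(\<Sum>\<phi>\<in>PiE {..<n} (\<lambda>_. A). R w \<phi>) \<le> 1 / card W" for w
  proof -
    have "(\<Sum>\<phi>\<in>PiE {..<n} (\<lambda>_. A). R w \<phi>) = 1 / card W * (\<Prod>t<n. \<Sum>a\<in>A. K a (g t w))"
      unfolding R_def sum_distrib_left[symmetric] using A by (subst prod_sum_PiE) auto
    also have "\<dots> \<le> 1 / card W * 1"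
      using Ksum K0 by (intro mult_left_mono prod_le_1) auto
    finally show ?thesis by simp
  qed
  have const: "has_bochner_integral M (\<lambda>x. a) a" for a :: real
    by (simp add: has_bochner_integral_iff prob_space)
  let ?B = "\<lambda>x. log 2 (card W) + (\<Sum>t<n. log 2 (1 / (1 - \<theta>)) + log 2 (card A / \<theta>) * indicator (E t) x)"
  have "simple_entropy M X \<le> (\<integral>x. ?B x \<partial>M)"
  proof (rule simple_entropy_le_integral[where r = r])
    show "0 < r (X x)" for x
      unfolding r_def by (rule sum_pos) (use W q R in auto)
    have "(\<Sum>\<phi>\<in>X ` space M. r \<phi>) \<le> (\<Sum>\<phi>\<in>PiE {..<n} (\<lambda>_. A). r \<phi>)"
    proof (rule sum_mono2)
      show "finite (PiE {..<n} (\<lambda>_. A))" using A by (intro finite_PiE) auto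
      show "X ` space M \<subseteq> PiE {..<n} (\<lambda>_. A)" using XA by blast
      show "0 \<le> r \<phi>" for \<phi> unfolding r_def by (intro sum_nonneg less_imp_le R)
    qed
    also have "\<dots> = (\<Sum>w\<in>W. \<Sum>\<phi>\<in>PiE {..<n} (\<lambda>_. A). R w \<phi>)"
      unfolding r_def by (rule sum.swap)
    also have "\<dots> \<le> (\<Sum>w\<in>W. 1 / card W)" by (intro sum_mono Rsum)
    also have "\<dots> = 1" using cW by simp
    finally show "(\<Sum>\<phi>\<in>X ` space M. r \<phi>) \<le> 1" .
    show "integrable M ?B"
      using E by (intro Bochner_Integration.integrable_add Bochner_Integration.integrable_sum
          integrable_mult_right integrable_real_indicator integrable_const) (auto simp: less_top[symmetric])
    fix x assume x: "x \<in> space M"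
    \<comment> \<open>Of the mixture only the component of the codeword actually sent is kept, which
      costs the term \<open>log 2 (card W)\<close>.\<close>
    have "R (q x) (X x) \<le> r (X x)"
      unfolding r_def by (rule member_le_sum) (use W q R in \<open>auto intro: less_imp_le\<close>)
    then have "- log 2 (r (X x)) \<le> - log 2 (R (q x) (X x))"
      using R by (simp add: less_le_trans[OF R])
    also have "\<dots> = log 2 (card W) + (\<Sum>t<n. - log 2 (K (X x t) (g t (q x))))"
    proof -
      have "log 2 (\<Prod>t<n. K (X x t) (g t (q x))) = (\<Sum>t<n. log 2 (K (X x t) (g t (q x))))"
        using K(1) by (simp add: log_def ln_prod sum_divide_distrib less_imp_neq[symmetric])
      moreover have "0 < (\<Prod>t<n. K (X x t) (g t (q x)))" by (intro prod_pos) (use K(1) in auto)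
      moreover have "- log 2 (1 / card W * z) = log 2 (card W) - log 2 z" if "0 < z" for z
        using that cW by (simp add: log_divide)
      ultimately show ?thesis unfolding R_def sum_negf by simp
    qed
    also have "\<dots> \<le> ?B x"
    proof (intro add_left_mono sum_mono)
      fix t assume t: "t \<in> {..<n}"
      show "- log 2 (K (X x t) (g t (q x))) \<le> log 2 (1 / (1 - \<theta>)) + log 2 (card A / \<theta>) * indicator (E t) x"
      proof (cases "x \<in> E t")
        case True
        have "log 2 (\<theta> / card A) \<le> log 2 (K (X x t) (g t (q x)))"
          using K(1,2) \<theta> cA by simp
        moreover have "log 2 (\<theta> / card A) = - log 2 (card A / \<theta>)"
          using \<theta> cA by (simp add: log_divide)
        moreover have "0 \<le> log 2 (1 / (1 - \<theta>))" using \<theta> by simp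
        ultimately show ?thesis using True by simp
      next
        case False
        then have "X x t = g t (q x)" using decode x t by auto
        then have "log 2 (1 - \<theta>) \<le> log 2 (K (X x t) (g t (q x)))"
          using K(1,3) \<theta> by simp
        moreover have "log 2 (1 / (1 - \<theta>)) = - log 2 (1 - \<theta>)"
          using \<theta> by (simp add: log_divide)
        ultimately show ?thesis using False by simp
      qed
    qed
    finally show "- log 2 (r (X x)) \<le> ?B x" .
  qed fact+
  also have "(\<integral>x. ?B x \<partial>M) = log 2 (card W) + (\<Sum>t<n. log 2 (1 / (1 - \<theta>)) + log 2 (card A / \<theta>) * measure M (E t))"
    by (rule has_bochner_integral_integral_eq, intro has_bochner_integral_add has_bochner_integral_sum
        has_bochner_integral_mult_right has_bochner_integral_real_indicator E const)
      (simp add: less_top[symmetric])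
  also have "\<dots> = log 2 (card W) + real n * log 2 (1 / (1 - \<theta>)) +
    log 2 (card A / \<theta>) * (\<Sum>t<n. measure M (E t))"
    by (simp add: sum.distrib sum_distrib_left)
  finally show ?thesis .
qed

subsection \<open>Coding and estimation policies\<close>

lemma coded_symbol_measurable:
  fixes f :: "'a::topological_space \<Rightarrow> 'a"
  assumes \<delta>: "coding_policy M \<delta>" and f: "f \<in> borel \<rightarrow>\<^sub>M borel"
  shows "(\<lambda>x. coded_symbol f \<delta> x t) \<in> borel \<rightarrow>\<^sub>M count_space M"
proof -
  have "(\<lambda>x. \<lambda>s\<in>{..t}. (f ^^ s) x) \<in> borel \<rightarrow>\<^sub>M PiM {..t} (\<lambda>_. borel)"
    by (intro measurable_restrict funpow_borel_measurable[OF f])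
  then show ?thesis
    unfolding coded_symbol_def
    by (rule measurable_compose) (use \<delta> in \<open>simp add: coding_policy_def\<close>)
qed

lemma coded_symbol_in_alphabet:
  fixes f :: "'a::topological_space \<Rightarrow> 'a"
  assumes "coding_policy M \<delta>" "f \<in> borel \<rightarrow>\<^sub>M borel"
  shows "coded_symbol f \<delta> x t \<in> M"
  using measurable_space[OF coded_symbol_measurable[OF assms], of x t] by simp

text \<open>The estimate depends on \<open>x\<close> only through one of finitely many received
  words, so the error is a finite sum over the fibres of the word; nothing is required of
  \<open>\<gamma>\<close>.\<close>

lemma estimation_error_measurable:
  fixes f :: "'a::metric_space \<Rightarrow> 'a"
  assumes \<delta>: "coding_policy M \<delta>" and M: "finite M" and f: "f \<in> borel \<rightarrow>\<^sub>M borel"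
  shows "(\<lambda>x. dist ((f ^^ t) x) (state_estimate f \<delta> \<gamma> x t)) \<in> borel_measurable borel"
proof -
  define word where "word x = (\<lambda>s\<in>{..t}. coded_symbol f \<delta> x s)" for x
  define W where "W = PiE {..t} (\<lambda>_. M)"
  have W: "finite W" unfolding W_def using M by (intro finite_PiE) auto
  have word: "word x \<in> W" for x
    unfolding word_def W_def using coded_symbol_in_alphabet[OF \<delta> f] by auto
  have fibre: "{x. word x = w} \<in> sets borel" if w: "w \<in> W" for w
  proof -
    have "{x. word x = w} = (\<Inter>s\<in>{..t}. (\<lambda>x. coded_symbol f \<delta> x s) -` {w s} \<inter> space borel)"
    proof (intro equalityI subsetI)
      fix x assume x: "x \<in> (\<Inter>s\<in>{..t}. (\<lambda>x. coded_symbol f \<delta> x s) -` {w s} \<inter> space borel)"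
      have "word x = w"
        by (rule PiE_ext[OF word[unfolded W_def] w[unfolded W_def]])
          (use x in \<open>auto simp: word_def\<close>)
      then show "x \<in> {x. word x = w}" by simp
    qed (auto simp: word_def)
    also have "\<dots> \<in> sets borel"
      using w unfolding W_def
      by (intro sets.finite_INT measurable_sets[OF coded_symbol_measurable[OF \<delta> f]]) auto
    finally show ?thesis .
  qed
  have dist: "(\<lambda>x. dist ((f ^^ t) x) c) \<in> borel_measurable borel" for c
    by (rule measurable_compose[OF funpow_borel_measurable[OF f]])
      (intro borel_measurable_continuous_onI continuous_intros)
  have "dist ((f ^^ t) x) (state_estimate f \<delta> \<gamma> x t) =
      (\<Sum>w\<in>W. indicator {x. word x = w} x * dist ((f ^^ t) x) (\<gamma> t w))" for x
  proof -
    have "(\<Sum>w\<in>W. indicator {x. word x = w} x * dist ((f ^^ t) x) (\<gamma> t w)) =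
      (\<Sum>w\<in>W. if word x = w then dist ((f ^^ t) x) (\<gamma> t w) else 0)"
      by (rule sum.cong) (auto simp: indicator_def)
    also have "\<dots> = dist ((f ^^ t) x) (\<gamma> t (word x))" using W word by simp
    finally show ?thesis unfolding state_estimate_def word_def by simp
  qed
  moreover have "(\<lambda>x. \<Sum>w\<in>W. indicator {x. word x = w} x * dist ((f ^^ t) x) (\<gamma> t w)) \<in> borel_measurable borel"
    by (intro borel_measurable_sum borel_measurable_times borel_measurable_indicator fibre dist)
  ultimately show ?thesis by simp
qed

lemma estimation_set_measurable:
  fixes f :: "'a::metric_space \<Rightarrow> 'a"
  assumes "coding_policy M \<delta>" "finite M" "f \<in> borel \<rightarrow>\<^sub>M borel"
  shows "{x. limsup (\<lambda>t. ereal (dist ((f ^^ t) x) (state_estimate f \<delta> \<gamma> x t))) \<le> ereal \<epsilon>} \<in> sets borel"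
proof -
  have [measurable]: "(\<lambda>x. dist ((f ^^ t) x) (state_estimate f \<delta> \<gamma> x t)) \<in> borel_measurable borel" for t
    by (rule estimation_error_measurable[OF assms])
  show ?thesis by measurable
qed

section \<open>Separated compact sets and decoding of itineraries\<close>

lemma compact_closed_separated:
  fixes S T :: "'a::metric_space set"
  assumes S: "compact S" and T: "closed T" and disj: "S \<inter> T = {}"
  shows "\<exists>d>0. \<forall>x\<in>S. \<forall>y\<in>T. d \<le> dist x y"
proof (cases "S = {} \<or> T = {}")
  case True
  then show ?thesis by (intro exI[of _ 1]) auto
next
  case False
  have "continuous_on S (\<lambda>x. infdist x T)" by (intro continuous_intros)
  then obtain x0 where x0: "x0 \<in> S" "\<And>x. x \<in> S \<Longrightarrow> infdist x0 T \<le> infdist x T"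
    using continuous_attains_inf[OF S, of "\<lambda>x. infdist x T"] False by blast
  have "infdist x0 T \<noteq> 0"
    using in_closed_iff_infdist_zero[OF T] False x0(1) disj by blast
  then have "0 < infdist x0 T" using infdist_nonneg[of x0 T] by linarith
  moreover have "infdist x0 T \<le> dist x y" if "x \<in> S" "y \<in> T" for x y
    using x0(2)[OF that(1)] infdist_le[OF that(2), of x] by linarith
  ultimately show ?thesis by blast
qed

lemma finite_disjoint_compact_separated:
  fixes C :: "'i \<Rightarrow> 'a::metric_space set"
  assumes "finite I" and C: "\<And>i. i \<in> I \<Longrightarrow> compact (C i)" and disj: "disjoint_family_on C I"
  shows "\<exists>d>0. \<forall>i\<in>I. \<forall>j\<in>I. \<forall>x\<in>C i. \<forall>y\<in>C j. dist x y < d \<longrightarrow> i = j"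
proof -
  have "\<exists>d>0. \<forall>x\<in>C i. \<forall>y\<in>C j. d \<le> dist x y" if "i \<in> I" "j \<in> I" "i \<noteq> j" for i j
    using that disj C
    by (intro compact_closed_separated compact_imp_closed) (auto simp: disjoint_family_on_def)
  then obtain D where D: "\<And>i j. i \<in> I \<Longrightarrow> j \<in> I \<Longrightarrow> i \<noteq> j \<Longrightarrow>
      0 < D i j \<and> (\<forall>x\<in>C i. \<forall>y\<in>C j. D i j \<le> dist x y)"
    by metis
  \<comment> \<open>The 1 keeps the minimum defined when there are no two distinct indices.\<close>
  define S where "S = insert (1::real) ((\<lambda>(i, j). D i j) ` {(i, j) \<in> I \<times> I. i \<noteq> j})"
  have "finite {(i, j) \<in> I \<times> I. i \<noteq> j}"
    by (rule finite_subset[of _ "I \<times> I"]) (use assms(1) in auto)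
  then have S: "finite S" "S \<noteq> {}" unfolding S_def by auto
  have "0 < Min S" using D by (subst Min_gr_iff[OF S]) (auto simp: S_def)
  moreover have "i = j" if "i \<in> I" "j \<in> I" "x \<in> C i" "y \<in> C j" "dist x y < Min S" for i j x y
  proof (rule ccontr)
    assume "i \<noteq> j"
    then have "Min S \<le> D i j" using that S by (intro Min_le) (auto simp: S_def)
    also have "\<dots> \<le> dist x y" using D that \<open>i \<noteq> j\<close> by blast
    finally show False using that by simp
  qed
  ultimately show ?thesis by blast
qed

text \<open>The order of quantifiers matters: \<open>\<epsilon>\<close> is fixed by
  \<open>\<mu>\<close>, \<open>P\<close> and \<open>\<eta>\<close> before any policy is given, so
  the bound applies to every alphabet competing in \<open>eps_capacity\<close> for this
  \<open>\<epsilon>\<close>.\<close>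

lemma metric_entropy_wrt_le_log_card:
  fixes f :: "'a::metric_space \<Rightarrow> 'a"
  assumes compact: "compact (UNIV :: 'a set)" and f: "f \<in> borel \<rightarrow>\<^sub>M borel"
    and \<mu>: "borel_prob \<mu>" and inv: "invariant_measure f \<mu>"
    and P: "finite_borel_partition P" and \<eta>: "0 < \<eta>"
  shows "\<exists>\<epsilon>>0. \<forall>M \<delta> \<gamma>. finite M \<longrightarrow> coding_policy M \<delta> \<longrightarrow> as_estimation_objective f \<mu> \<epsilon> \<delta> \<gamma> \<longrightarrow>
    metric_entropy_wrt \<mu> f P \<le> log 2 (card M) + \<eta>"
proof -
  have M: "sets \<mu> = sets borel" and ps: "prob_space \<mu>" using \<mu> unfolding borel_prob_def by auto
  interpret prob_space \<mu> by fact
  note [measurable_cong] = M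
  have sp: "space \<mu> = UNIV" using sets_eq_imp_space_eq[OF M] by simp
  have P': "partition_on UNIV P" "finite P" "P \<subseteq> sets borel"
    using P unfolding finite_borel_partition_def by auto
  have "P \<noteq> {}" using partition_onD1[OF P'(1)] by auto
  then have k: "1 \<le> card P" using P'(2) by (simp add: Suc_le_eq card_gt_0_iff)

  \<comment> \<open>The loss \<open>\<eta>\<close> is split: trusting the decoder costs
    \<open>\<eta> / 4\<close> per symbol. With \<open>c\<close> the price of a failure,
    \<open>p\<close> is chosen so that failures of probability \<open>2 * p\<close> cost
    \<open>\<eta> / 2\<close> per symbol.\<close>
  define \<theta> where "\<theta> = 1 - 2 powr (- \<eta> / 4)"
  have \<theta>: "0 < \<theta>" "\<theta> < 1" using \<eta> by (auto simp: \<theta>_def powr_less_one)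
  have log\<theta>: "log 2 (1 / (1 - \<theta>)) = \<eta> / 4" by (simp add: \<theta>_def log_divide)
  define c where "c = log 2 (card P / \<theta>)"
  have "1 < card P / \<theta>" using k \<theta> by simp
  then have c: "0 < c" unfolding c_def by simp
  define p where "p = \<eta> / (4 * c)"
  have p: "0 < p" unfolding p_def using \<eta> c by simp

  have "\<exists>C. closed C \<and> C \<subseteq> A \<and> measure \<mu> (A - C) < p / card P" if A: "A \<in> P" for A
  proof -
    obtain C U where CU: "closed C" "open U" "C \<subseteq> A" "A \<subseteq> U" "measure \<mu> (U - C) < p / card P"
      using closed_open_approximation[OF finite_measure_axioms M, of A "p / card P"] A P'(3) p k
      by (auto simp: subset_iff)
    have "measure \<mu> (A - C) \<le> measure \<mu> (U - C)"
      using CU M by (intro finite_measure_mono) auto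
    then show ?thesis using CU by (intro exI[of _ C]) auto
  qed
  then obtain C where C: "\<And>A. A \<in> P \<Longrightarrow> closed (C A)" "\<And>A. A \<in> P \<Longrightarrow> C A \<subseteq> A"
    "\<And>A. A \<in> P \<Longrightarrow> measure \<mu> (A - C A) < p / card P"
    by metis
  define K where "K = (\<Union>A\<in>P. C A)"
  have K: "K \<in> sets borel" unfolding K_def using C(1) P'(2) by (intro borel_closed closed_UN) auto
  have AC: "A - C A \<in> sets \<mu>" if "A \<in> P" for A using that C(1) P'(3) M by auto
  have "measure \<mu> (- K) \<le> measure \<mu> (\<Union>A\<in>P. A - C A)"
  proof (rule finite_measure_mono)
    show "- K \<subseteq> (\<Union>A\<in>P. A - C A)" using partition_onD1[OF P'(1)] unfolding K_def by blast
    show "(\<Union>A\<in>P. A - C A) \<in> sets \<mu>" using AC P'(2) by (intro sets.finite_UN) auto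
  qed
  also have "\<dots> \<le> (\<Sum>A\<in>P. measure \<mu> (A - C A))"
    using AC P'(2) by (intro finite_measure_subadditive_finite) auto
  also have "\<dots> \<le> (\<Sum>A\<in>P. p / card P)" using C(3) by (intro sum_mono less_imp_le)
  also have "\<dots> = p" using k by simp
  finally have muK: "measure \<mu> (- K) \<le> p" .

  have "disjoint_family_on C P"
    using C(2) P'(1) unfolding disjoint_family_on_def partition_on_def disjoint_def by blast
  moreover have "compact (C A)" if "A \<in> P" for A
    using compact_Int_closed[OF compact C(1)[OF that]] by simp
  ultimately obtain d where d: "0 < d"
    "\<And>A B x y. A \<in> P \<Longrightarrow> B \<in> P \<Longrightarrow> x \<in> C A \<Longrightarrow> y \<in> C B \<Longrightarrow> dist x y < d \<Longrightarrow> A = B"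
    using finite_disjoint_compact_separated[OF P'(2), of C] by blast

  \<comment> \<open>With \<open>\<epsilon> = d / 3\<close>, the error is eventually below
    \<open>d / 2\<close>; two points within \<open>d / 2\<close> of the same estimate are less than
    \<open>d\<close> apart, so they cannot lie in different sets \<open>C A\<close>.\<close>
  have "metric_entropy_wrt \<mu> f P \<le> log 2 (card M) + \<eta>"
    if M': "finite M" "coding_policy M \<delta>" "as_estimation_objective f \<mu> (d / 3) \<delta> \<gamma>" for M \<delta> \<gamma>
  proof -
    define err where "err t x = dist ((f ^^ t) x) (state_estimate f \<delta> \<gamma> x t)" for t x
    have [measurable]: "err t \<in> borel_measurable borel" for t
      unfolding err_def by (rule estimation_error_measurable[OF M'(2,1) f])
    define G where "G = {x. limsup (\<lambda>t. ereal (err t x)) \<le> ereal (d / 3)}"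
    have G: "G \<in> sets borel" "measure \<mu> G = 1"
      using estimation_set_measurable[OF M'(2,1) f] M'(3)
      unfolding G_def err_def as_estimation_objective_def by auto
    \<comment> \<open>As in Egorov's theorem, the sets \<open>N T\<close> decrease to a null set, so
      one time \<open>T\<close> serves all initial states outside a set of measure below
      \<open>p\<close>.\<close>
    define N where "N T = {x. \<exists>s\<ge>T. \<not> err s x < d / 2}" for T :: nat
    have N: "N T \<in> sets \<mu>" for T unfolding N_def M by measurable
    have "(\<lambda>T. measure \<mu> (N T)) \<longlonglongrightarrow> measure \<mu> (\<Inter>T. N T)"
    proof (rule finite_Lim_measure_decseq)
      show "range N \<subseteq> sets \<mu>" using N by auto
      show "decseq N" unfolding decseq_def N_def by (auto intro: order_trans)
    qed
    moreover have "measure \<mu> (\<Inter>T. N T) = 0"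
    proof -
      have "(\<Inter>T. N T) \<subseteq> UNIV - G"
      proof
        fix x assume x: "x \<in> (\<Inter>T. N T)"
        have "x \<notin> G"
        proof
          assume "x \<in> G"
          then have "limsup (\<lambda>t. ereal (err t x)) < ereal (d / 2)"
            using d(1) unfolding G_def by (auto elim: le_less_trans)
          then have "\<forall>\<^sub>F t in sequentially. ereal (err t x) < ereal (d / 2)"
            by (rule Limsup_lessD)
          then obtain T where "\<And>t. t \<ge> T \<Longrightarrow> err t x < d / 2"
            unfolding eventually_sequentially by auto
          then show False using x unfolding N_def by blast
        qed
        then show "x \<in> UNIV - G" by simp
      qed
      then have "measure \<mu> (\<Inter>T. N T) \<le> measure \<mu> (UNIV - G)"
        using G(1) M by (intro finite_measure_mono) auto
      also have "\<dots> = 0" using prob_compl[of G] G M sp by simp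
      finally show ?thesis using measure_nonneg[of \<mu> "\<Inter>T. N T"] by linarith
    qed
    ultimately have "\<forall>\<^sub>F T in sequentially. measure \<mu> (N T) < p"
      using p by (intro order_tendstoD(2)) auto
    then obtain T where T: "measure \<mu> (N T) < p" by (auto simp: eventually_sequentially)

    \<comment> \<open>Decoding at time \<open>t\<close> is given up if the state lies outside
      \<open>K\<close>, if \<open>x\<close> is in the exceptional set \<open>N T\<close>, or for
      every \<open>x\<close> before time \<open>T\<close>. The last case adds at most
      \<open>T\<close> in total, whatever \<open>n\<close> is.\<close>
    define E where "E t = (f ^^ t) -` (- K) \<union> (if t < T then UNIV else N T)" for t
    have preK: "(f ^^ t) -` (- K) \<in> sets \<mu>" for t
      using measurable_sets[OF funpow_borel_measurable[OF f], of "- K"] K M by simp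
    have UN: "(if t < T then UNIV else N T) \<in> sets \<mu>" for t
      using N sets.top[of \<mu>] sp by auto
    have E: "E t \<in> sets \<mu>" for t unfolding E_def using preK UN by (rule sets.Un)
    have muE: "measure \<mu> (E t) \<le> 2 * p + (if t < T then 1 else 0)" for t
    proof -
      have "measure \<mu> (E t) \<le> measure \<mu> ((f ^^ t) -` (- K)) + measure \<mu> (if t < T then UNIV else N T)"
        unfolding E_def using preK UN by (rule measure_Un_le)
      moreover have "measure \<mu> ((f ^^ t) -` (- K)) \<le> p"
        using invariant_measure_funpow[OF inv f M, of "- K"] K muK by simp
      moreover have "measure \<mu> (if t < T then UNIV else N T) \<le> p + (if t < T then 1 else 0)"
        using T p prob_space sp by auto
      ultimately show ?thesis by linarith
    qed
    have sumE: "(\<Sum>t<n. measure \<mu> (E t)) \<le> real n * (2 * p) + real T" for n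
    proof -
      have "(\<Sum>t<n. measure \<mu> (E t)) \<le> (\<Sum>t<n. 2 * p + (if t < T then 1 else 0))"
        by (intro sum_mono muE)
      also have "\<dots> = real n * (2 * p) + real (card ({..<n} \<inter> {..<T}))"
        by (simp add: sum.distrib sum.If_cases lessThan_def)
      also have "card ({..<n} \<inter> {..<T}) \<le> T"
        using card_mono[of "{..<T}" "{..<n} \<inter> {..<T}"] by simp
      finally show ?thesis by simp
    qed

    \<comment> \<open>The decoder guesses the cell whose compact part comes within
      \<open>d / 2\<close> of the estimate. Restricting \<open>w\<close> to \<open>{..t}\<close>
      leaves the symbols received by time \<open>t\<close>, in the form that
      \<open>state_estimate\<close> feeds to \<open>\<gamma>\<close>.\<close>
    define g where "g t w = (SOME A. A \<in> P \<and> (\<exists>y\<in>C A. dist y (\<gamma> t (restrict w {..t})) < d / 2))" for t w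
    define q where "q n x = (\<lambda>s\<in>{..<n}. coded_symbol f \<delta> x s)" for n x
    have q: "q n x \<in> PiE {..<n} (\<lambda>_. M)" for n x
      unfolding q_def using coded_symbol_in_alphabet[OF M'(2) f] by auto
    have decode: "itinerary f P n x t = g t (q n x)" if t: "t < n" and x: "x \<notin> E t" for n t x
    proof -
      have "restrict (q n x) {..t} = (\<lambda>s\<in>{..t}. coded_symbol f \<delta> x s)"
        unfolding q_def by (rule restrict_ext) (use t in auto)
      then have est: "\<gamma> t (restrict (q n x) {..t}) = state_estimate f \<delta> \<gamma> x t"
        unfolding state_estimate_def by simp
      have "\<not> t < T" and K': "(f ^^ t) x \<in> K" and "x \<notin> N T"
        using x unfolding E_def by (auto split: if_splits)
      then have err: "dist ((f ^^ t) x) (state_estimate f \<delta> \<gamma> x t) < d / 2"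
        unfolding N_def err_def by auto
      obtain A where A: "A \<in> P" "(f ^^ t) x \<in> C A" using K' unfolding K_def by auto
      have "g t (q n x) = A"
        unfolding g_def est
      proof (rule some_equality)
        show "A \<in> P \<and> (\<exists>y\<in>C A. dist y (state_estimate f \<delta> \<gamma> x t) < d / 2)"
          using A err by blast
        fix B assume "B \<in> P \<and> (\<exists>y\<in>C B. dist y (state_estimate f \<delta> \<gamma> x t) < d / 2)"
        then obtain y where y: "B \<in> P" "y \<in> C B" "dist y (state_estimate f \<delta> \<gamma> x t) < d / 2"
          by auto
        have "dist y ((f ^^ t) x) < d" using dist_triangle_half_l[of "state_estimate f \<delta> \<gamma> x t" y d] y(3) err
          by (metis dist_commute dist_triangle_half_r)
        then show "B = A" by (rule d(2)[OF y(1) A(1) y(2) A(2)])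
      qed
      moreover have "itinerary f P n x t = A"
        using t partition_cell_eq[OF P'(1) A(1)] A C(2) unfolding itinerary_def by auto
      ultimately show ?thesis by simp
    qed
    have cardM: "0 < card M"
      using coded_symbol_in_alphabet[OF M'(2) f] M'(1) by (auto simp: card_gt_0_iff)
    have bound: "1 / real n * partition_entropy \<mu> (refined_partition f P n) \<le>
        log 2 (card M) + 3 / 4 * \<eta> + c * real T / real n" if n: "0 < n" for n
    proof -
      have "partition_entropy \<mu> (refined_partition f P n) = simple_entropy \<mu> (itinerary f P n)"
        by (rule partition_entropy_refined[OF P'(1) sp])
      also have "\<dots> \<le> log 2 (card (PiE {..<n} (\<lambda>_. M))) + real n * log 2 (1 / (1 - \<theta>)) +
          log 2 (card P / \<theta>) * (\<Sum>t<n. measure \<mu> (E t))"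
      proof (rule simple_entropy_le_code_rate[where g = g and q = "q n"])
        show "itinerary f P n x t = g t (q n x)" if "t < n" "x \<in> space \<mu> - E t" for t x
          using decode that by blast
        show "finite (PiE {..<n} (\<lambda>_. M))" using M'(1) by (intro finite_PiE) auto
      qed (fact ps itinerary_simple_function[OF P f M] itinerary_in_PiE[OF P'(1)] P'(2) \<open>P \<noteq> {}\<close> q E \<theta>)+
      also have "log 2 (card (PiE {..<n} (\<lambda>_. M))) = real n * log 2 (card M)"
        using cardM by (simp add: card_PiE log_nat_power)
      also have "log 2 (card P / \<theta>) * (\<Sum>t<n. measure \<mu> (E t)) \<le> c * (real n * (2 * p) + real T)"
        unfolding c_def[symmetric] using c sumE by (intro mult_left_mono) auto
      also have "\<dots> = real n * (\<eta> / 2) + c * real T"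
        unfolding p_def using c by (simp add: field_simps)
      finally have "partition_entropy \<mu> (refined_partition f P n) \<le>
          real n * (log 2 (card M) + 3 / 4 * \<eta>) + c * real T"
        unfolding log\<theta> by (simp add: algebra_simps)
      then have "partition_entropy \<mu> (refined_partition f P n) / real n \<le>
          (real n * (log 2 (card M) + 3 / 4 * \<eta>) + c * real T) / real n"
        by (rule divide_right_mono) simp
      then show ?thesis using n by (simp add: add_divide_distrib)
    qed
    \<comment> \<open>The contribution \<open>c * real T\<close> of the initial times is bounded in
      \<open>n\<close> and disappears after division by \<open>n\<close>.\<close>
    have "metric_entropy_wrt \<mu> f P \<le> log 2 (card M) + 3 / 4 * \<eta> + 0"
    proof (rule LIMSEQ_le)
      show "(\<lambda>n. 1 / real n * partition_entropy \<mu> (refined_partition f P n)) \<longlonglongrightarrow> metric_entropy_wrt \<mu> f P"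
        by (rule refined_entropy_converges[OF P f \<mu> inv])
      show "(\<lambda>n. log 2 (card M) + 3 / 4 * \<eta> + c * real T / real n) \<longlonglongrightarrow> log 2 (card M) + 3 / 4 * \<eta> + 0"
        by (intro tendsto_add tendsto_const lim_const_over_n)
      show "\<exists>N. \<forall>n\<ge>N. 1 / real n * partition_entropy \<mu> (refined_partition f P n) \<le>
          log 2 (card M) + 3 / 4 * \<eta> + c * real T / real n"
        using bound by (intro exI[of _ 1]) auto
    qed
    then show ?thesis using \<eta> by simp
  qed
  then show ?thesis using d(1) by (intro exI[of _ "d / 3"]) auto
qed

section \<open>Change of measure, comparison of alphabets, and the limit of small errors\<close>

text \<open>The failure event is a Borel null set of \<open>\<pi>\<close>, hence of
  \<open>\<mu>\<close>; the same policy works for both.\<close>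

lemma as_estimation_objective_absolutely_continuous:
  fixes f :: "'a::metric_space \<Rightarrow> 'a"
  assumes f: "f \<in> borel \<rightarrow>\<^sub>M borel" and \<pi>: "borel_prob \<pi>" and \<mu>: "borel_prob \<mu>"
    and ac: "absolutely_continuous \<pi> \<mu>"
    and M: "finite M" "coding_policy M \<delta>" and obj: "as_estimation_objective f \<pi> \<epsilon> \<delta> \<gamma>"
  shows "as_estimation_objective f \<mu> \<epsilon> \<delta> \<gamma>"
proof -
  interpret P: prob_space \<pi> using \<pi> unfolding borel_prob_def by simp
  interpret Q: prob_space \<mu> using \<mu> unfolding borel_prob_def by simp
  have sets: "sets \<pi> = sets borel" "sets \<mu> = sets borel" using \<pi> \<mu> unfolding borel_prob_def by auto
  define G where "G = {x. limsup (\<lambda>t. ereal (dist ((f ^^ t) x) (state_estimate f \<delta> \<gamma> x t))) \<le> ereal \<epsilon>}"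
  have G: "G \<in> sets borel" unfolding G_def by (rule estimation_set_measurable[OF M(2,1) f])
  have "measure \<pi> (space \<pi> - G) = 0"
    using P.prob_compl[of G] G obj sets unfolding as_estimation_objective_def G_def by simp
  then have "space \<pi> - G \<in> null_sets \<pi>"
    using G sets by (auto simp: null_sets_def P.emeasure_eq_measure)
  then have "space \<pi> - G \<in> null_sets \<mu>" using ac unfolding absolutely_continuous_def by blast
  then have "measure \<mu> (space \<mu> - G) = 0"
    using sets_eq_imp_space_eq[OF sets(1)] sets_eq_imp_space_eq[OF sets(2)]
    by (simp add: null_sets_def Q.emeasure_eq_measure)
  then have "measure \<mu> G = 1" using Q.prob_compl[of G] G sets by simp
  then show ?thesis unfolding as_estimation_objective_def G_def .
qed

lemma sufficient_alphabet_mono: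
  fixes f :: "'a::metric_space \<Rightarrow> 'a"
  assumes f: "f \<in> borel \<rightarrow>\<^sub>M borel" and \<pi>: "borel_prob \<pi>"
    and suff: "sufficient_alphabet f \<pi> \<epsilon> M" and le: "\<epsilon> \<le> \<epsilon>'"
  shows "sufficient_alphabet f \<pi> \<epsilon>' M"
proof -
  interpret prob_space \<pi> using \<pi> unfolding borel_prob_def by simp
  have sets: "sets \<pi> = sets borel" using \<pi> unfolding borel_prob_def by simp
  obtain \<delta> \<gamma> where M: "finite M" "M \<noteq> {}" "coding_policy M \<delta>" "as_estimation_objective f \<pi> \<epsilon> \<delta> \<gamma>"
    using suff unfolding sufficient_alphabet_def by auto
  let ?G = "\<lambda>\<epsilon>. {x. limsup (\<lambda>t. ereal (dist ((f ^^ t) x) (state_estimate f \<delta> \<gamma> x t))) \<le> ereal \<epsilon>}"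
  have "?G \<epsilon> \<subseteq> ?G \<epsilon>'" using le by (auto elim: order_trans)
  then have "measure \<pi> (?G \<epsilon>) \<le> measure \<pi> (?G \<epsilon>')"
    using estimation_set_measurable[OF M(3,1) f] sets by (intro finite_measure_mono) auto
  then have "as_estimation_objective f \<pi> \<epsilon>' \<delta> \<gamma>"
    using M(4) prob_le_1[of "?G \<epsilon>'"] unfolding as_estimation_objective_def by linarith
  then show ?thesis using M unfolding sufficient_alphabet_def by blast
qed

text \<open>Symbols are sent through an injection \<open>\<iota>\<close> of \<open>M'\<close> into
  \<open>M\<close>, and the new estimator undoes it before applying \<open>\<gamma>\<close>. This
  makes alphabets that vary with \<open>\<epsilon>\<close> comparable.\<close>

lemma sufficient_alphabet_card_mono:
  assumes suff: "sufficient_alphabet f \<pi> \<epsilon> M'" and M: "finite M" and le: "card M' \<le> card M"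
  shows "sufficient_alphabet f \<pi> \<epsilon> M"
proof -
  obtain \<delta> \<gamma> where M': "finite M'" "M' \<noteq> {}" and \<delta>: "coding_policy M' \<delta>"
      and obj: "as_estimation_objective f \<pi> \<epsilon> \<delta> \<gamma>"
    using suff unfolding sufficient_alphabet_def by auto
  obtain \<iota> where \<iota>: "inj_on \<iota> M'" "\<iota> ` M' \<subseteq> M" using card_le_inj[OF M'(1) M le] by auto
  define \<delta>' where "\<delta>' t w = \<iota> (\<delta> t w)" for t w
  define \<gamma>' where "\<gamma>' t w = \<gamma> t (\<lambda>s\<in>{..t}. the_inv_into M' \<iota> (w s))" for t w
  have in_M': "coded_symbol f \<delta> x t \<in> M'" for x t
  proof -
    have "\<delta> t \<in> measurable (PiM {..t} (\<lambda>_. borel)) (count_space M')"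
      using \<delta> unfolding coding_policy_def by blast
    moreover have "(\<lambda>s\<in>{..t}. (f ^^ s) x) \<in> space (PiM {..t} (\<lambda>_. borel))"
      by (simp add: space_PiM)
    ultimately show ?thesis unfolding coded_symbol_def by (auto dest: measurable_space)
  qed
  have "state_estimate f \<delta>' \<gamma>' x t = state_estimate f \<delta> \<gamma> x t" for x t
  proof -
    have "the_inv_into M' \<iota> (coded_symbol f \<delta>' x s) = coded_symbol f \<delta> x s" for s
      using the_inv_into_f_f[OF \<iota>(1) in_M'] unfolding coded_symbol_def \<delta>'_def by simp
    then show ?thesis unfolding state_estimate_def \<gamma>'_def by (auto intro!: arg_cong[where f = "\<gamma> t"])
  qed
  then have "as_estimation_objective f \<pi> \<epsilon> \<delta>' \<gamma>'"
    using obj unfolding as_estimation_objective_def by simp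
  moreover have "coding_policy M \<delta>'"
    unfolding coding_policy_def \<delta>'_def
  proof
    fix t
    have "\<delta> t \<in> measurable (PiM {..t} (\<lambda>_. borel)) (count_space M')"
      using \<delta> unfolding coding_policy_def by blast
    then show "(\<lambda>w. \<iota> (\<delta> t w)) \<in> measurable (PiM {..t} (\<lambda>_. borel)) (count_space M)"
      by (rule measurable_compose) (use \<iota>(2) in auto)
  qed
  moreover have "M \<noteq> {}" using M' le by auto
  ultimately show ?thesis using M unfolding sufficient_alphabet_def by blast
qed

text \<open>A larger tolerance admits more alphabets, so \<open>eps_capacity\<close> is antitone in
  \<open>\<epsilon>\<close>; its limit at 0 from the right exists and is the supremum.\<close>

lemma smallest_capacity_eq_SUP:
  fixes f :: "'a::metric_space \<Rightarrow> 'a"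
  assumes f: "f \<in> borel \<rightarrow>\<^sub>M borel" and \<pi>: "borel_prob \<pi>"
  shows "smallest_capacity f \<pi> = (SUP \<epsilon>\<in>{0<..}. eps_capacity f \<pi> \<epsilon>)"
proof -
  have antimono: "eps_capacity f \<pi> \<epsilon>' \<le> eps_capacity f \<pi> \<epsilon>" if "\<epsilon> \<le> \<epsilon>'" for \<epsilon> \<epsilon>'
    unfolding eps_capacity_def
    by (intro INF_superset_mono) (use sufficient_alphabet_mono[OF f \<pi> _ that] in auto)
  have "(eps_capacity f \<pi> \<longlongrightarrow> (SUP \<epsilon>\<in>{0<..}. eps_capacity f \<pi> \<epsilon>)) (at_right 0)"
  proof (rule increasing_tendsto)
    show "\<forall>\<^sub>F \<epsilon> in at_right 0. eps_capacity f \<pi> \<epsilon> \<le> (SUP \<epsilon>\<in>{0<..}. eps_capacity f \<pi> \<epsilon>)"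
      by (rule eventually_at_rightI[of 0 1]) (auto intro!: SUP_upper)
    fix y assume "y < (SUP \<epsilon>\<in>{0<..}. eps_capacity f \<pi> \<epsilon>)"
    then obtain \<epsilon>0 where \<epsilon>0: "0 < \<epsilon>0" "y < eps_capacity f \<pi> \<epsilon>0" by (auto simp: less_SUP_iff)
    show "\<forall>\<^sub>F \<epsilon> in at_right 0. y < eps_capacity f \<pi> \<epsilon>"
      by (rule eventually_at_rightI[of 0 \<epsilon>0])
        (use \<epsilon>0 antimono in \<open>auto intro: less_le_trans\<close>)
  qed
  then show ?thesis unfolding smallest_capacity_def by (intro tendsto_Lim) auto
qed

text \<open>Covers both cases of the theorem, the invariant one being \<open>\<mu> = \<pi>\<close>.
  If no alphabet suffices for some \<open>\<epsilon>\<close>, the infimum is infinite and the bound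
  is trivial there.\<close>

lemma metric_entropy_le_smallest_capacity:
  fixes f :: "'a::metric_space \<Rightarrow> 'a"
  assumes compact: "compact (UNIV :: 'a set)" and f: "f \<in> borel \<rightarrow>\<^sub>M borel"
    and \<pi>: "borel_prob \<pi>" and \<mu>: "borel_prob \<mu>" and inv: "invariant_measure f \<mu>"
    and ac: "absolutely_continuous \<pi> \<mu>"
  shows "metric_entropy \<mu> f \<le> smallest_capacity f \<pi>"
  unfolding metric_entropy_def
proof (rule SUP_least)
  fix P :: "'a set set" assume "P \<in> {P. finite_borel_partition P}"
  then have P: "finite_borel_partition P" by simp
  show "ereal (metric_entropy_wrt \<mu> f P) \<le> smallest_capacity f \<pi>"
  proof (rule ereal_le_epsilon2)
    fix \<eta> :: real assume \<eta>: "0 < \<eta>"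
    obtain \<epsilon> where \<epsilon>: "0 < \<epsilon>"
      "\<And>M \<delta> \<gamma>. finite M \<Longrightarrow> coding_policy M \<delta> \<Longrightarrow> as_estimation_objective f \<mu> \<epsilon> \<delta> \<gamma> \<Longrightarrow>
        metric_entropy_wrt \<mu> f P \<le> log 2 (card M) + \<eta>"
      using metric_entropy_wrt_le_log_card[OF compact f \<mu> inv P \<eta>] by blast
    have "ereal (metric_entropy_wrt \<mu> f P - \<eta>) \<le> eps_capacity f \<pi> \<epsilon>"
      unfolding eps_capacity_def
    proof (rule INF_greatest)
      fix M assume "M \<in> {M. sufficient_alphabet f \<pi> \<epsilon> M}"
      then obtain \<delta> \<gamma> where "finite M" "coding_policy M \<delta>" "as_estimation_objective f \<pi> \<epsilon> \<delta> \<gamma>"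
        unfolding sufficient_alphabet_def by auto
      then have "metric_entropy_wrt \<mu> f P \<le> log 2 (card M) + \<eta>"
        using as_estimation_objective_absolutely_continuous[OF f \<pi> \<mu> ac] \<epsilon>(2) by blast
      then show "ereal (metric_entropy_wrt \<mu> f P - \<eta>) \<le> ereal (log 2 (card M))" by simp
    qed
    also have "\<dots> \<le> smallest_capacity f \<pi>"
      unfolding smallest_capacity_eq_SUP[OF f \<pi>] using \<epsilon>(1) by (intro SUP_upper) auto
    finally have "ereal (metric_entropy_wrt \<mu> f P - \<eta>) + ereal \<eta> \<le> smallest_capacity f \<pi> + ereal \<eta>"
      by (rule add_right_mono)
    then show "ereal (metric_entropy_wrt \<mu> f P) \<le> smallest_capacity f \<pi> + ereal \<eta>" by simp
  qed
qed

text \<open>One alphabet good for every \<open>\<epsilon>\<close> bounds all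
  \<open>eps_capacity\<close> values by its log-cardinality. Conversely, a finite capacity bounds
  the sizes of suitable alphabets uniformly in \<open>\<epsilon>\<close>, and they can all be
  enlarged to a common one.\<close>

lemma smallest_capacity_eq_infinity_iff:
  fixes f :: "'a::metric_space \<Rightarrow> 'a"
  assumes f: "f \<in> borel \<rightarrow>\<^sub>M borel" and \<pi>: "borel_prob \<pi>"
  shows "smallest_capacity f \<pi> = \<infinity> \<longleftrightarrow> \<not> (\<exists>M. \<forall>\<epsilon>>0. sufficient_alphabet f \<pi> \<epsilon> M)"
proof
  assume inf: "smallest_capacity f \<pi> = \<infinity>"
  show "\<not> (\<exists>M. \<forall>\<epsilon>>0. sufficient_alphabet f \<pi> \<epsilon> M)"
  proof
    assume "\<exists>M. \<forall>\<epsilon>>0. sufficient_alphabet f \<pi> \<epsilon> M"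
    then obtain M where M: "\<And>\<epsilon>. 0 < \<epsilon> \<Longrightarrow> sufficient_alphabet f \<pi> \<epsilon> M" by blast
    have "smallest_capacity f \<pi> \<le> ereal (log 2 (card M))"
      unfolding smallest_capacity_eq_SUP[OF f \<pi>] eps_capacity_def
      using M by (intro SUP_least INF_lower) auto
    then show False using inf by simp
  qed
next
  assume none: "\<not> (\<exists>M. \<forall>\<epsilon>>0. sufficient_alphabet f \<pi> \<epsilon> M)"
  show "smallest_capacity f \<pi> = \<infinity>"
  proof (rule ereal_top)
    fix b :: real
    show "ereal b \<le> smallest_capacity f \<pi>"
    proof (rule ccontr)
      assume "\<not> ereal b \<le> smallest_capacity f \<pi>"
      then have small: "smallest_capacity f \<pi> < ereal b" by simp
      \<comment> \<open>Capacity below \<open>b\<close> yields, for each \<open>\<epsilon>\<close>,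
        a sufficient alphabet with fewer than \<open>2 powr b\<close> symbols, which embeds into
        \<open>{..<N}\<close>.\<close>
      define N where "N = nat \<lceil>2 powr b\<rceil>"
      have "sufficient_alphabet f \<pi> \<epsilon> {..<N}" if "0 < \<epsilon>" for \<epsilon>
      proof -
        have "eps_capacity f \<pi> \<epsilon> \<le> smallest_capacity f \<pi>"
          unfolding smallest_capacity_eq_SUP[OF f \<pi>] using that by (intro SUP_upper) auto
        then have "eps_capacity f \<pi> \<epsilon> < ereal b" using small by (rule le_less_trans)
        then obtain M where M: "sufficient_alphabet f \<pi> \<epsilon> M" "log 2 (card M) < b"
          unfolding eps_capacity_def by (auto simp: INF_less_iff)
        have "0 < card M" using M(1) unfolding sufficient_alphabet_def by (simp add: card_gt_0_iff)
        then have "real (card M) < 2 powr b" using M(2) by (simp add: log_less_iff)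
        then have "card M \<le> card {..<N}" unfolding N_def by (simp, linarith)
        then show ?thesis using sufficient_alphabet_card_mono[OF M(1)] by blast
      qed
      then show False using none by blast
    qed
  qed
qed

theorem mainTheorem4:
  fixes f :: "'a::metric_space \<Rightarrow> 'a" and \<pi>\<^sub>0 :: "'a measure"
  assumes "compact (UNIV :: 'a set)"
    and "\<exists>g. homeomorphism UNIV UNIV f g"
    and "borel_prob \<pi>\<^sub>0"
  shows "(invariant_measure f \<pi>\<^sub>0 \<longrightarrow> smallest_capacity f \<pi>\<^sub>0 \<ge> metric_entropy \<pi>\<^sub>0 f) \<and>
    (\<not> invariant_measure f \<pi>\<^sub>0 \<longrightarrow>
      (\<forall>\<mu>. borel_prob \<mu> \<and> invariant_measure f \<mu> \<and> absolutely_continuous \<pi>\<^sub>0 \<mu> \<longrightarrow>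
        smallest_capacity f \<pi>\<^sub>0 \<ge> metric_entropy \<mu> f)) \<and>
    (smallest_capacity f \<pi>\<^sub>0 = \<infinity> \<longleftrightarrow> \<not> (\<exists>M. \<forall>\<epsilon>>0. sufficient_alphabet f \<pi>\<^sub>0 \<epsilon> M))"
proof -
  have "continuous_on UNIV f" using assms(2) unfolding homeomorphism_def by blast
  then have f: "f \<in> borel \<rightarrow>\<^sub>M borel" by (rule borel_measurable_continuous_onI)
  have "absolutely_continuous \<pi>\<^sub>0 \<pi>\<^sub>0" unfolding absolutely_continuous_def by simp
  then show ?thesis
    using metric_entropy_le_smallest_capacity[OF assms(1) f assms(3)] assms(3)
      smallest_capacity_eq_infinity_iff[OF f assms(3)]
    by blast
qed

end
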